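(* Let $\mathrm{G}$ be a $[1,h]_{\mathbb{N}}$-marked digraph on $v_1,\dots,v_n$ satisfying both Property $P_1$ and Property $P_2$. Then $\mathrm{G}$ is a structurally observable graph (SOG); that is, every discrete-time system $x_i[k+1]=f_i((x_\alpha[k])_{\alpha\in\mathbf{N}_i})$ ($i=1,\dots,n$), $y_j[k]=x_j[k]$ ($j=1,\dots,h$), whose interaction digraph is $\mathrm{G}$ and in which every $f_i$ that is a function of a single variable is injective, is observable.
   Context: The system has state $\mathbf{x}[k]=(x_1[k],\dots,x_n[k])\in\mathbb{R}^n$, output $\mathbf{y}[k]\in\mathbb{R}^h$, $k=0,1,2,\dots$, with $\mathbf{N}_i\subseteq\{1,\dots,n\}$ and $f_i:\mathbb{R}^{|\mathbf{N}_i|}\to\mathbb{R}$. Its interaction digraph $\mathrm{G}=(\mathrm{V},\mathrm{E})$ has $\mathrm{V}=\{v_1,\dots,v_n\}$ and the in-neighbors of $v_i$ are exactly the $v_j$ with $j\in\mathbf{N}_i$, i.e. $(v_j,v_i)\in\mathrm{E}$ iff $j\in\mathbf{N}_i$. The system is observable if for any two different initial states at $k=0$ the output sequences differ at some time $k\geq 0$. The standing assumption is that each $f_i$ with $|\mathbf{N}_i|=1$ is injective. A $[1,h]_{\mathbb{N}}$-marked digraph is a digraph on $v_1,\dots,v_n$ in which $v_1,\dots,v_h$ are marked as directly observable; the other vertices are called simple. A cycle is a closed walk along directed edges without repeated vertices other than start = end (a self-loop is a cycle). Property $P_1$: for every simple vertex $v$ there is a vertex $v'$ whose unique in-neighbor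 is $v$. Property $P_2$: for every cycle $C$ consisting entirely of simple vertices there is a vertex $v\notin C$ whose unique in-neighbor is some vertex $v'\in C$. *)

theory Defs
  imports Complex_Main "HOL-Library.FuncSet" "Graph_Theory.Pair_Digraph"
begin

section \<open>Marked digraphs\<close>

text \<open>
  The vertex \<open>v\<^sub>i\<close> is the number \<open>i\<close>. The locale predicate \<^const>\<open>pair_fin_digraph\<close> permits
  self-loops but, arcs being pairs, no parallel arcs.
\<close>

definition marked_digraph :: "nat \<Rightarrow> nat \<Rightarrow> nat pair_pre_digraph \<Rightarrow> bool" where
  "marked_digraph h n G \<longleftrightarrow> pair_fin_digraph G \<and> pverts G = {1..n} \<and> h \<le> n"

definition simple_verts :: "nat \<Rightarrow> nat pair_pre_digraph \<Rightarrow> nat set" where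
  "simple_verts h G = pverts G - {1..h}"

definition in_neighbors :: "'a pair_pre_digraph \<Rightarrow> 'a \<Rightarrow> 'a set" where
  "in_neighbors G v = {u. (u, v) \<in> parcs G}"

definition property_P1 :: "nat \<Rightarrow> nat pair_pre_digraph \<Rightarrow> bool" where
  "property_P1 h G \<longleftrightarrow>
     (\<forall>v \<in> simple_verts h G. \<exists>v' \<in> pverts G. in_neighbors G v' = {v})"

text \<open>
  \<^const>\<open>pre_digraph.cycle\<close> represents a cycle by its nonempty list of arcs and counts a self-loop
  as a cycle. Since the walk is closed, its vertices are exactly the tails of its arcs.
\<close>

definition cycle_verts :: "('a \<times> 'a) awalk \<Rightarrow> 'a set" where
  "cycle_verts p = fst ` set p"

definition property_P2 :: "nat \<Rightarrow> nat pair_pre_digraph \<Rightarrow> bool" where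
  "property_P2 h G \<longleftrightarrow>
     (\<forall>p. pre_digraph.cycle (with_proj G) p \<and> cycle_verts p \<subseteq> simple_verts h G \<longrightarrow>
        (\<exists>v \<in> pverts G - cycle_verts p. \<exists>v' \<in> cycle_verts p. in_neighbors G v = {v'}))"


section \<open>Discrete-time systems\<close>

text \<open>
  The coordinate space of a finite index set \<open>I\<close> is \<open>I \<rightarrow>\<^sub>E UNIV\<close>, so that a state is an element of
  \<open>{1..n} \<rightarrow>\<^sub>E UNIV\<close> and the update function of component \<open>i\<close> is a function on
  \<open>in_idx S i \<rightarrow>\<^sub>E UNIV\<close>; its values elsewhere are never used.
\<close>

record dt_system =
  state_dim :: nat
  out_dim :: nat
  in_idx :: "nat \<Rightarrow> nat set"
  update :: "nat \<Rightarrow> (nat \<Rightarrow> real) \<Rightarrow> real"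

definition wf_system :: "dt_system \<Rightarrow> bool" where
  "wf_system S \<longleftrightarrow>
     out_dim S \<le> state_dim S \<and> (\<forall>i \<in> {1..state_dim S}. in_idx S i \<subseteq> {1..state_dim S})"

definition states :: "dt_system \<Rightarrow> (nat \<Rightarrow> real) set" where
  "states S = {1..state_dim S} \<rightarrow>\<^sub>E UNIV"

primrec state :: "dt_system \<Rightarrow> (nat \<Rightarrow> real) \<Rightarrow> nat \<Rightarrow> nat \<Rightarrow> real" where
  "state S x0 0 = x0"
| "state S x0 (Suc k) =
     (\<lambda>i \<in> {1..state_dim S}. update S i (restrict (state S x0 k) (in_idx S i)))"

definition out :: "dt_system \<Rightarrow> (nat \<Rightarrow> real) \<Rightarrow> nat \<Rightarrow> nat \<Rightarrow> real" where
  "out S x0 k = restrict (state S x0 k) {1..out_dim S}"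

definition observable :: "dt_system \<Rightarrow> bool" where
  "observable S \<longleftrightarrow>
     (\<forall>x0 \<in> states S. \<forall>x0' \<in> states S. x0 \<noteq> x0' \<longrightarrow> (\<exists>k. out S x0 k \<noteq> out S x0' k))"

definition interaction_digraph :: "dt_system \<Rightarrow> nat pair_pre_digraph" where
  "interaction_digraph S =
     \<lparr> pverts = {1..state_dim S},
       parcs = {(j, i). i \<in> {1..state_dim S} \<and> j \<in> in_idx S i} \<rparr>"

definition single_var_injective :: "dt_system \<Rightarrow> bool" where
  "single_var_injective S \<longleftrightarrow>
     (\<forall>i \<in> {1..state_dim S}. card (in_idx S i) = 1 \<longrightarrow>
        inj_on (update S i) (in_idx S i \<rightarrow>\<^sub>E UNIV))"

definition structurally_observable :: "nat \<Rightarrow> nat pair_pre_digraph \<Rightarrow> bool" where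
  "structurally_observable h G \<longleftrightarrow>
     (\<forall>S. wf_system S \<and> out_dim S = h \<and> interaction_digraph S = G \<and> single_var_injective S
        \<longrightarrow> observable S)"

end

(*
  Fix two initial states with equal outputs, and let U be the set of vertices at which the two
  trajectories differ at some time. If v is the unique in-neighbor of w and the trajectories agree
  at w, then they agree at v by injectivity; so every w whose unique in-neighbor lies in U lies in U
  itself. By P1 this gives an injective, hence bijective, successor map on U. An orbit of that map
  is a cycle of simple vertices that is closed under successors, whereas P2 would yield a successor
  of one of its vertices outside of it. Hence U is empty.
*)

theory Submission
  imports Defs "HOL-Combinatorics.Cycles"
begin

lemma cas_map_upt:
  "pre_digraph.cas (with_proj G) (a 0) (map (\<lambda>i. (a i, a (Suc i))) [0..<m]) (a m)"
proof (induction m arbitrary: a)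
  case 0
  then show ?case by (simp add: pre_digraph.cas.simps)
next
  case (Suc m)
  \<comment> \<open>\<open>cas\<close> consumes the first arc, so the induction hypothesis is needed
    for the sequence shifted by one.\<close>
  show ?case
    using Suc[of "\<lambda>i. a (Suc i)"]
    by (simp add: map_upt_Suc pre_digraph.cas.simps del: upt_Suc)
qed

lemma awalk_verts_map_upt:
  "pre_digraph.awalk_verts (with_proj G) (a 0) (map (\<lambda>i. (a i, a (Suc i))) [0..<m]) =
     map a [0..<Suc m]"
proof (induction m arbitrary: a)
  case 0
  then show ?case by (simp add: pre_digraph.awalk_verts.simps)
next
  case (Suc m)
  show ?case
    using Suc[of "\<lambda>i. a (Suc i)"]
    by (simp add: map_upt_Suc pre_digraph.awalk_verts.simps del: upt_Suc)
qed

text \<open>The cycle is the orbit of \<open>v\<close>, traversed once. Its closure under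
  \<open>f\<close> is what will clash with P2.\<close>

lemma permutes_obtain_cycle:
  assumes perm: "f permutes U" and fin: "finite U" and U: "U \<subseteq> pverts G"
    and arcs: "\<And>u. u \<in> U \<Longrightarrow> (u, f u) \<in> parcs G"
    and v: "v \<in> U"
  obtains p where "pre_digraph.cycle (with_proj G) p" "cycle_verts p \<subseteq> U"
    "\<And>x. x \<in> cycle_verts p \<Longrightarrow> f x \<in> cycle_verts p"
proof -
  have P: "permutation f" using perm fin by (auto simp: permutation_permutes)
  define a where "a = (\<lambda>i. (f ^^ i) v)"
  define m where "m = least_power f v"
  define p where "p = map (\<lambda>i. (a i, a (Suc i))) [0..<m]"
  have m: "a m = v" "m > 0"
    using least_power_of_permutation[OF P, of v] by (auto simp: a_def m_def)
  have a_U: "a i \<in> U" for i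
    by (induction i) (use v permutes_in_image[OF perm] in \<open>auto simp: a_def\<close>)
  \<comment> \<open>The first \<open>m\<close> iterates already exhaust the whole orbit; in the form
    \<open>range a\<close>, closure under \<open>f\<close> is immediate.\<close>
  have verts: "cycle_verts p = range a"
    using support_set[OF P, of v]
    by (simp add: cycle_verts_def p_def a_def m_def image_image)
  have "distinct (map a [0..<m])"
    using cycle_of_permutation[OF P, of v] by (simp add: a_def m_def)
  \<comment> \<open>\<open>cycle\<close> asks for distinctness of the vertex list without its head,
    that is of \<open>a 1\<close>, ..., \<open>a m\<close>; injectivity of \<open>f\<close> carries
    distinctness over from \<open>a 0\<close>, ..., \<open>a (m - 1)\<close>.\<close>
  then have "distinct (map f (map a [0..<m]))"
    using permutes_inj_on[OF perm] by (simp only: distinct_map)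
  then have dist: "distinct (map (\<lambda>i. a (Suc i)) [0..<m])"
    by (simp add: a_def comp_def)
  have "set p \<subseteq> parcs G"
    using arcs a_U by (auto simp: p_def a_def)
  then have "pre_digraph.awalk (with_proj G) v p v"
    using cas_map_upt[of G a m] m U v
    by (auto simp: pre_digraph.awalk_def p_def a_def)
  moreover have "distinct (tl (pre_digraph.awalk_verts (with_proj G) v p))"
    using awalk_verts_map_upt[of G a m] dist
    by (simp add: p_def a_def map_upt_Suc del: upt_Suc)
  moreover have "p \<noteq> []" using m by (simp add: p_def)
  ultimately have "pre_digraph.cycle (with_proj G) p"
    by (auto simp: pre_digraph.cycle_def)
  moreover have "cycle_verts p \<subseteq> U" using verts a_U by auto
  moreover have "f x \<in> cycle_verts p" if x: "x \<in> cycle_verts p" for x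
  proof -
    obtain i where "x = a i" using x verts by auto
    then have "f x = a (Suc i)" by (simp add: a_def)
    then show ?thesis using verts by simp
  qed
  ultimately show thesis by (rule that)
qed

text \<open>The value at \<open>w\<close> at time \<open>Suc k\<close> is an injective function of
  the value at \<open>v\<close> at time \<open>k\<close>, so the latter can be read off one step
  later.\<close>

lemma states_agree_at_in_neighbor:
  assumes inj: "single_var_injective S"
    and w: "w \<in> {1..state_dim S}" and idx: "in_idx S w = {v}"
    and agree: "\<And>k. state S x k w = state S y k w"
  shows "state S x k v = state S y k v"
proof -
  have "update S w (restrict (state S x k) {v}) = update S w (restrict (state S y k) {v})"
    using agree[of "Suc k"] w idx by simp
  moreover have "inj_on (update S w) (in_idx S w \<rightarrow>\<^sub>E UNIV)"
  proof -
    have "card (in_idx S w) = 1" by (simp add: idx)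
    with inj w show ?thesis unfolding single_var_injective_def by blast
  qed
  ultimately have "restrict (state S x k) {v} = restrict (state S y k) {v}"
    unfolding idx by (elim inj_onD) simp_all
  from fun_cong[OF this, of v] show ?thesis by simp
qed

text \<open>This is the purely combinatorial half; \<open>U\<close> will be the set of vertices
  where two trajectories with equal outputs differ.\<close>

lemma successor_closed_set_empty:
  assumes P1: "property_P1 h G" and P2: "property_P2 h G"
    and fin: "finite U" and U: "U \<subseteq> simple_verts h G"
    and closed: "\<And>v w. v \<in> U \<Longrightarrow> w \<in> pverts G \<Longrightarrow> in_neighbors G w = {v} \<Longrightarrow> w \<in> U"
  shows "U = {}"
proof (rule ccontr)
  assume "U \<noteq> {}"
  then obtain v where v: "v \<in> U" by blast
  have "\<forall>u \<in> U. \<exists>w \<in> U. in_neighbors G w = {u}"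
    using P1 U closed unfolding property_P1_def by (meson subsetD)
  then obtain s where s: "\<And>u. u \<in> U \<Longrightarrow> s u \<in> U \<and> in_neighbors G (s u) = {u}"
    by metis
  \<comment> \<open>\<open>permutes\<close> requires the identity outside \<open>U\<close>.\<close>
  define f where "f = (\<lambda>u. if u \<in> U then s u else u)"
  \<comment> \<open>The in-neighborhood of \<open>s u\<close> is \<open>{u}\<close>, so
    \<open>s u\<close> determines \<open>u\<close>.\<close>
  have inj: "inj_on f U"
    by (rule inj_onI) (metis f_def s singleton_inject)
  have "f ` U \<subseteq> U" using s by (auto simp: f_def)
  then have bij: "bij_betw f U U"
    using endo_inj_surj[OF fin _ inj] inj by (simp add: bij_betw_def)
  then have perm: "f permutes U"
    by (rule bij_imp_permutes) (simp add: f_def)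
  have UG: "U \<subseteq> pverts G" using U by (auto simp: simple_verts_def)
  have arcs: "(u, f u) \<in> parcs G" if "u \<in> U" for u
    using s[OF that] that by (auto simp: f_def in_neighbors_def)
  obtain p where p: "pre_digraph.cycle (with_proj G) p" "cycle_verts p \<subseteq> U"
    "\<And>x. x \<in> cycle_verts p \<Longrightarrow> f x \<in> cycle_verts p"
    using permutes_obtain_cycle[OF perm fin UG arcs v] by blast
  then obtain w v' where w: "w \<in> pverts G" "w \<notin> cycle_verts p" "v' \<in> cycle_verts p"
    "in_neighbors G w = {v'}"
    using P2 U unfolding property_P2_def by blast
  \<comment> \<open>Surjectivity makes \<open>w\<close> a value \<open>f u\<close>, and its unique
    in-neighbor forces \<open>u = v'\<close>. Hence \<open>w\<close> is the image of a cycle vertex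
    and lies on the cycle after all.\<close>
  then have "w \<in> U" using closed p by blast
  then obtain u where u: "u \<in> U" "w = f u" using bij by (auto simp: bij_betw_def)
  then have "u = v'" using s[of u] w by (simp add: f_def)
  then show False using u w p by blast
qed

theorem theorem2:
  fixes h n :: nat and G :: "nat pair_pre_digraph"
  assumes "marked_digraph h n G"
    and "property_P1 h G"
    and "property_P2 h G"
  shows "structurally_observable h G"
  unfolding structurally_observable_def observable_def
proof (intro allI impI ballI, elim conjE, rule ccontr)
  fix S x y
  assume wf: "wf_system S" and dim: "out_dim S = h" and G: "interaction_digraph S = G"
    and inj: "single_var_injective S"
    and x: "x \<in> states S" and y: "y \<in> states S" and "x \<noteq> y"
    and "\<nexists>k. out S x k \<noteq> out S y k"
  then have out: "\<And>k. out S x k = out S y k" by blast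
  define U where "U = {v \<in> {1..state_dim S}. \<exists>k. state S x k v \<noteq> state S y k v}"
  have V: "pverts G = {1..state_dim S}" using G by (auto simp: interaction_digraph_def)
  have nbrs: "in_neighbors G w = in_idx S w" if "w \<in> pverts G" for w
    using that G by (auto simp: interaction_digraph_def in_neighbors_def)
  \<comment> \<open>Marked vertices are output coordinates, so equal outputs keep them out of
    \<open>U\<close>.\<close>
  have "state S x k v = state S y k v" if "v \<in> {1..h}" for k v
    using fun_cong[OF out[of k], of v] that dim by (simp add: out_def)
  then have U_simple: "U \<subseteq> simple_verts h G"
    using V by (auto simp: U_def simple_verts_def)
  have closed: "w \<in> U"
    if "v \<in> U" and w: "w \<in> pverts G" and "in_neighbors G w = {v}" for v w
  proof (rule ccontr)
    assume "w \<notin> U"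
    then have agree: "state S x k w = state S y k w" for k
      using w V by (auto simp: U_def)
    have "w \<in> {1..state_dim S}" "in_idx S w = {v}"
      using that V nbrs[OF w] by auto
    then have "state S x k v = state S y k v" for k
      using agree by (rule states_agree_at_in_neighbor[OF inj])
    then show False using \<open>v \<in> U\<close> by (simp add: U_def)
  qed
  have "finite U" by (simp add: U_def)
  then have "U = {}"
    using U_simple closed by (rule successor_closed_set_empty[OF assms(2,3)])
  then have "state S x 0 v = state S y 0 v" if "v \<in> {1..state_dim S}" for v
    using that unfolding U_def by blast
  \<comment> \<open>States are extensional functions, so agreement on the index set at time 0 is
    equality.\<close>
  then have "x = y"
    using PiE_ext[OF x[unfolded states_def] y[unfolded states_def]] by simp
  with \<open>x \<noteq> y\<close> show False ..
qed

end
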